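(* For every $y\in R^\infty$ and every $j\geq 1$, \[ \delta_2(y; j) = \sum_{i=1}^{j-1} y(i)\,V_2(y,i+1,j). \]
   Context: Fix a positive integer $n$ and let $R = \mathbb{F}_2[x_1,\ldots,x_n]/\langle x_i^2 - x_i : 1 \leq i \leq n\rangle$. Let $R^\infty$ be the set of sequences $y=(y(i))_{i=1}^\infty$ of elements of $R$. Empty sums are $0$ and empty products are $1$. For $y\in R^\infty$ and $j\ge 1$ define \[ \delta_2(y; j) = \sum_{k=0}^{j-2} y(j-k)\,y(j-k-1) \prod_{i=1}^k \bigl(y(j-i+1)+y(j-i)\bigr). \] For $1\le a\le b$ define \[ V_2(y,a,b) = \prod_{i=1}^{b-a+1}\bigl( y(a+i-1)+ \mathbf{1}(i \equiv 0 \pmod 2)\bigr), \] where $\mathbf{1}(\cdot)\in\{0,1\}$ is the indicator of the stated condition, regarded as an element of $R$; thus $V_2(y,a,b)=y(a)(1+y(a+1))y(a+2)(1+y(a+3))\cdots$, ending with the factor involving $y(b)$. *)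

theory Defs
  imports HOL.Modules "HOL-Library.Poly_Mapping" "HOL-Library.Z2"
begin

text \<open>
  Polynomials over the two-element field in variables indexed by \<open>'n\<close>: an element of
  \<^typ>\<open>'n \<Rightarrow>\<^sub>0 nat\<close> is the exponent vector of a monomial.
  For \<open>'n\<close> finite, the number of variables is \<open>n = CARD('n) \<ge> 1\<close>.
\<close>

type_synonym 'n f2_poly = "('n \<Rightarrow>\<^sub>0 nat) \<Rightarrow>\<^sub>0 bit"

definition Var :: "'n \<Rightarrow> 'n f2_poly" where
  "Var i = Poly_Mapping.single (Poly_Mapping.single i 1) 1"

text \<open>Ideals are submodules of the ring over itself, so the generated ideal is the span.\<close>

definition bool_ideal :: "'n f2_poly set" where
  "bool_ideal = module.span (*) {Var i ^ 2 - Var i | i. True}"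

lemma module_mult: "module ((*) :: 'a::comm_ring_1 \<Rightarrow> 'a \<Rightarrow> 'a)"
  by unfold_locales (simp_all add: algebra_simps)

lemma bool_ideal_zero: "0 \<in> bool_ideal"
  unfolding bool_ideal_def by (rule module.span_zero[OF module_mult])

lemma bool_ideal_add: "p \<in> bool_ideal \<Longrightarrow> q \<in> bool_ideal \<Longrightarrow> p + q \<in> bool_ideal"
  unfolding bool_ideal_def by (rule module.span_add[OF module_mult])

lemma bool_ideal_uminus: "p \<in> bool_ideal \<Longrightarrow> - p \<in> bool_ideal"
  unfolding bool_ideal_def by (rule module.span_neg[OF module_mult])

lemma bool_ideal_mult: "p \<in> bool_ideal \<Longrightarrow> c * p \<in> bool_ideal"
  unfolding bool_ideal_def by (rule module.span_scale[OF module_mult])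

lemma lookup_mult_zero:
  fixes p q :: "'n f2_poly"
  assumes "Poly_Mapping.lookup q 0 = 0"
  shows "Poly_Mapping.lookup (p * q) 0 = 0"
proof -
  have *: "0 = l + m \<longleftrightarrow> l = 0 \<and> m = 0" for l m :: "'n \<Rightarrow>\<^sub>0 nat"
    by (auto simp: poly_mapping_eq_iff fun_eq_iff lookup_add)
  have "(Poly_Mapping.lookup q m when 0 = l + m) = 0" for l m :: "'n \<Rightarrow>\<^sub>0 nat"
    using assms by (auto simp: * when_def)
  then show ?thesis
    by (simp add: lookup_mult)
qed

lemma one_notin_bool_ideal: "1 \<notin> (bool_ideal :: 'n f2_poly set)"
proof
  assume "1 \<in> (bool_ideal :: 'n f2_poly set)"
  moreover have "Poly_Mapping.lookup p 0 = 0" if "p \<in> bool_ideal" for p :: "'n f2_poly"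
    using that unfolding bool_ideal_def
  proof (rule module.span_induct[OF module_mult])
    show "module.subspace (*) {p :: 'n f2_poly. Poly_Mapping.lookup p 0 = 0}"
      by (auto simp: module.subspace_def[OF module_mult] lookup_add lookup_mult_zero)
  next
    fix p :: "'n f2_poly"
    assume "p \<in> {Var i ^ 2 - Var i | i. True}"
    then obtain i where p: "p = Var i * Var i - Var i"
      by (auto simp: power2_eq_square)
    have "Poly_Mapping.single i (1::nat) \<noteq> 0"
      by (metis lookup_single_eq lookup_zero one_neq_zero)
    then have "Poly_Mapping.lookup (Var i) 0 = 0"
      by (simp add: Var_def lookup_single when_def)
    then show "Poly_Mapping.lookup p 0 = 0"
      by (simp add: p lookup_minus lookup_mult_zero)
  qed
  ultimately have "Poly_Mapping.lookup (1 :: 'n f2_poly) 0 = 0"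
    by blast
  then show False
    by (simp add: lookup_one)
qed

definition bool_cong :: "'n f2_poly \<Rightarrow> 'n f2_poly \<Rightarrow> bool" where
  "bool_cong p q \<longleftrightarrow> p - q \<in> bool_ideal"

lemma equivp_bool_cong: "equivp bool_cong"
proof (rule equivpI)
  show "reflp bool_cong"
    by (simp add: reflp_def bool_cong_def bool_ideal_zero)
  show "symp bool_cong"
    by (metis sympI bool_cong_def bool_ideal_uminus minus_diff_eq)
  show "transp bool_cong"
  proof (rule transpI)
    fix p q r :: "'n f2_poly"
    assume "bool_cong p q" "bool_cong q r"
    then show "bool_cong p r"
      unfolding bool_cong_def using bool_ideal_add[of "p - q" "q - r"] by simp
  qed
qed

quotient_type 'n bool_ring = "'n f2_poly" / bool_cong
  by (rule equivp_bool_cong)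

instantiation bool_ring :: (type) comm_ring_1
begin

lift_definition zero_bool_ring :: "'a bool_ring" is 0 .

lift_definition one_bool_ring :: "'a bool_ring" is 1 .

lift_definition plus_bool_ring :: "'a bool_ring \<Rightarrow> 'a bool_ring \<Rightarrow> 'a bool_ring" is "(+)"
proof -
  fix p p' q q' :: "'a f2_poly"
  assume "bool_cong p p'" "bool_cong q q'"
  then show "bool_cong (p + q) (p' + q')"
    unfolding bool_cong_def using bool_ideal_add[of "p - p'" "q - q'"]
    by (simp add: algebra_simps)
qed

lift_definition uminus_bool_ring :: "'a bool_ring \<Rightarrow> 'a bool_ring" is uminus
proof -
  fix p p' :: "'a f2_poly"
  assume "bool_cong p p'"
  then show "bool_cong (- p) (- p')"
    unfolding bool_cong_def using bool_ideal_uminus[of "p - p'"] by simp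
qed

lift_definition minus_bool_ring :: "'a bool_ring \<Rightarrow> 'a bool_ring \<Rightarrow> 'a bool_ring" is "(-)"
proof -
  fix p p' q q' :: "'a f2_poly"
  assume "bool_cong p p'" "bool_cong q q'"
  then show "bool_cong (p - q) (p' - q')"
    unfolding bool_cong_def using bool_ideal_add[of "p - p'" "- (q - q')"] bool_ideal_uminus[of "q - q'"]
    by (simp add: algebra_simps)
qed

lift_definition times_bool_ring :: "'a bool_ring \<Rightarrow> 'a bool_ring \<Rightarrow> 'a bool_ring" is "(*)"
proof -
  fix p p' q q' :: "'a f2_poly"
  assume "bool_cong p p'" "bool_cong q q'"
  then have "q * (p - p') + p' * (q - q') \<in> bool_ideal"
    unfolding bool_cong_def by (intro bool_ideal_add bool_ideal_mult)
  then show "bool_cong (p * q) (p' * q')"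
    unfolding bool_cong_def by (simp add: algebra_simps)
qed

instance
proof
  show "(0 :: 'a bool_ring) \<noteq> 1"
  proof transfer
    show "\<not> bool_cong (0 :: 'a f2_poly) 1"
      using bool_ideal_uminus[of "- 1 :: 'a f2_poly"] one_notin_bool_ideal
      by (auto simp: bool_cong_def)
  qed
qed (transfer; simp add: bool_cong_def bool_ideal_zero algebra_simps)+

end

text \<open>
  A sequence \<open>(y(i))\<close>, \<open>i \<ge> 1\<close>, is a function on \<^typ>\<open>nat\<close>; its value at \<open>0\<close> is
  never used for \<open>1 \<le> a\<close> and \<open>1 \<le> j\<close>. The range \<open>0 \<le> k \<le> j - 2\<close> is written \<open>k < j - 1\<close>,
  because truncated subtraction would make \<open>{0..j - 2}\<close> nonempty for \<open>j = 1\<close>.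
\<close>

definition delta2 :: "(nat \<Rightarrow> 'n bool_ring) \<Rightarrow> nat \<Rightarrow> 'n bool_ring" where
  "delta2 y j = (\<Sum>k<j - 1. y (j - k) * y (j - k - 1) * (\<Prod>i=1..k. y (j - i + 1) + y (j - i)))"

definition V2 :: "(nat \<Rightarrow> 'n bool_ring) \<Rightarrow> nat \<Rightarrow> nat \<Rightarrow> 'n bool_ring" where
  "V2 y a b = (\<Prod>i=1..b - a + 1. y (a + i - 1) + of_bool (i mod 2 = 0))"

end

theory Submission imports Defs
begin

text \<open>
  \<open>R\<close> is a Boolean ring. Passing from \<open>j\<close> to \<open>j + 1\<close> multiplies \<open>V\<^sub>2(y, i + 1, j)\<close> by
  \<open>y(j + 1) + e\<close>, where \<open>e\<close> is \<open>1\<close> if the last factor of \<open>V\<^sub>2(y, i + 1, j)\<close> is \<open>y(j)\<close> and \<open>0\<close>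
  if it is \<open>y(j) + 1\<close>. By idempotence \<open>e\<close> may be replaced by \<open>y(j)\<close> in both cases. Hence both
  sides satisfy \<open>f(j + 1) = y(j) y(j + 1) + (y(j) + y(j + 1)) f(j)\<close> with \<open>f(1) = 0\<close>.
\<close>

text \<open>Turns the updates of \<open>update_induct\<close> into sums, both for exponent vectors
  and for polynomials.\<close>

lemma update_eq_single_add:
  assumes "k \<notin> Poly_Mapping.keys f"
  shows "Poly_Mapping.update k v f = Poly_Mapping.single k v + f"
  using assms
  by (intro poly_mapping_eqI) (auto simp: lookup_update lookup_add lookup_single when_def in_keys_iff)

lemma bool_ring_add_self: "a + a = 0" for a :: "'n bool_ring"
proof transfer
  fix p :: "'n f2_poly"
  have "p + p = 0"
    by (rule poly_mapping_eqI) (simp only: lookup_add lookup_zero, simp)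
  then show "bool_cong (p + p) 0"
    by (simp add: bool_cong_def bool_ideal_zero)
qed

lemma Var_idem: "abs_bool_ring (Var i) * abs_bool_ring (Var i) = abs_bool_ring (Var i)"
proof -
  have "Var i ^ 2 - Var i \<in> bool_ideal"
    unfolding bool_ideal_def by (rule module.span_base[OF module_mult]) blast
  then show ?thesis
    by (simp add: times_bool_ring.abs_eq bool_ring.abs_eq_iff bool_cong_def power2_eq_square)
qed

text \<open>Every monomial is a product of variables, and in a commutative ring products of
  idempotents are idempotent.\<close>

lemma monomial_idem:
  "abs_bool_ring (Poly_Mapping.single m 1) * abs_bool_ring (Poly_Mapping.single m 1) =
    abs_bool_ring (Poly_Mapping.single m 1)" (is "?q m * ?q m = ?q m")
proof -
  have one: "?q 0 = 1"
    by (simp add: one_bool_ring.abs_eq)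
  have add: "?q (l + m) = ?q l * ?q m" for l m
    by (simp add: times_bool_ring.abs_eq mult_single)
  have idem_add: "?q (l + m) * ?q (l + m) = ?q (l + m)"
    if "?q l * ?q l = ?q l" "?q m * ?q m = ?q m" for l m
    using that unfolding add by (metis mult.assoc mult.commute)
  have var_power: "?q (Poly_Mapping.single i k) * ?q (Poly_Mapping.single i k) =
    ?q (Poly_Mapping.single i k)" for i k
  proof (induction k)
    case 0
    show ?case unfolding single_zero one by simp
  next
    case (Suc k)
    have "Poly_Mapping.single i (Suc k) = Poly_Mapping.single i 1 + Poly_Mapping.single i k"
      by (simp flip: single_add)
    then show ?case
      using idem_add[OF _ Suc] Var_idem[of i] by (simp add: Var_def)
  qed
  show ?thesis
  proof (induction m rule: update_induct)
    case const
    show ?case unfolding one by simp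
  next
    case (update m i k)
    then show ?case
      using idem_add[OF var_power] by (simp add: update_eq_single_add)
  qed
qed

text \<open>Squaring is additive in characteristic 2, and every polynomial is a sum of
  monomials.\<close>

lemma bool_ring_mult_self: "a * a = a" for a :: "'n bool_ring"
proof (rule bool_ring.abs_induct)
  fix p :: "'n f2_poly"
  show "abs_bool_ring p * abs_bool_ring p = abs_bool_ring p"
  proof (induction p rule: update_induct)
    case const
    then show ?case by (simp flip: zero_bool_ring.abs_eq)
  next
    case (update p m c)
    let ?m = "abs_bool_ring (Poly_Mapping.single m 1)" and ?p = "abs_bool_ring p"
    \<comment> \<open>\<open>update_induct\<close> gives \<open>c \<noteq> 0\<close>, hence
      \<open>c = 1\<close> in \<open>bit\<close>.\<close>
    have "abs_bool_ring (Poly_Mapping.update m c p) = ?m + ?p"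
      using update by (simp add: update_eq_single_add plus_bool_ring.abs_eq)
    moreover have "(?m + ?p) * (?m + ?p) = ?m * ?m + ?p * ?p + (?m * ?p + ?m * ?p)"
      by (simp only: distrib_left distrib_right mult.commute add_ac)
    ultimately show ?case
      by (simp only: bool_ring_add_self monomial_idem update add_0_right)
  qed
qed

lemma delta2_Suc:
  assumes "j \<ge> 1"
  shows "delta2 y (Suc j) = y j * y (Suc j) + (y j + y (Suc j)) * delta2 y j"
proof -
  obtain n where j: "j = Suc n"
    using assms by (cases j) auto
  \<comment> \<open>The factor \<open>i = 1\<close> does not depend on \<open>k\<close>, so it can
    be pulled out of all summands but the first.\<close>
  have prod: "(\<Prod>i=1..Suc k. y (Suc j - i + 1) + y (Suc j - i))
      = (y j + y (Suc j)) * (\<Prod>i=1..k. y (j - i + 1) + y (j - i))" for k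
    by (subst prod.atLeast_Suc_atMost) (simp_all add: prod.shift_bounds_cl_Suc_ivl add.commute
        del: prod.cl_ivl_Suc)
  have "delta2 y (Suc j) = (\<Sum>k<Suc n. y (Suc j - k) * y (Suc j - k - 1) *
      (\<Prod>i=1..k. y (Suc j - i + 1) + y (Suc j - i)))"
    by (simp add: delta2_def j)
  also have "\<dots> = y j * y (Suc j) + (\<Sum>k<n. y (j - k) * y (j - k - 1) *
      (\<Prod>i=1..Suc k. y (Suc j - i + 1) + y (Suc j - i)))"
    by (subst sum.lessThan_Suc_shift) (simp add: mult.commute)
  also have "\<dots> = y j * y (Suc j) + (y j + y (Suc j)) * delta2 y j"
    unfolding prod by (simp add: delta2_def j sum_distrib_left mult_ac)
  finally show ?thesis .
qed

lemma V2_self: "V2 y a a = y a"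
  by (simp add: V2_def)

text \<open>The new factor has index \<open>b - a + 2\<close>, of the same parity as
  \<open>b - a\<close>.\<close>

lemma V2_Suc:
  assumes "a \<le> b"
  shows "V2 y a (Suc b) = V2 y a b * (y (Suc b) + of_bool (even (b - a)))"
  using assms by (simp add: V2_def Suc_diff_le flip: even_iff_mod_2_eq_zero)

text \<open>For even \<open>b - a\<close> the last factor is \<open>y b\<close>, which absorbs
  another \<open>y b\<close>; for odd \<open>b - a\<close> it is \<open>y b + 1\<close>, which
  \<open>y b\<close> annihilates.\<close>

lemma V2_mult_last:
  assumes "a \<le> b"
  shows "V2 y a b * y b = V2 y a b * of_bool (even (b - a))"
proof (cases "a = b")
  case True
  then show ?thesis by (simp add: V2_self bool_ring_mult_self)
next
  case False
  then obtain c where c: "b = Suc c" "a \<le> c"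
    using assms by (cases b) auto
  have "(y b + of_bool (even (c - a))) * y b =
      (y b + of_bool (even (c - a))) * of_bool (even (b - a))"
    using c by (simp add: distrib_right bool_ring_mult_self bool_ring_add_self Suc_diff_le)
  then show ?thesis
    using c by (simp add: V2_Suc mult.assoc)
qed

lemma V2_Suc':
  assumes "a \<le> b"
  shows "V2 y a (Suc b) = (y b + y (Suc b)) * V2 y a b"
  using V2_mult_last[OF assms, of y] by (simp add: V2_Suc[OF assms] algebra_simps)

theorem theorem3:
  fixes y :: "nat \<Rightarrow> 'n::finite bool_ring" and j :: nat
  assumes "j \<ge> 1"
  shows "delta2 y j = (\<Sum>i=1..j - 1. y i * V2 y (i + 1) j)"
  using assms
proof (induction j rule: dec_induct)
  case base
  then show ?case by (simp add: delta2_def)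
next
  case (step j)
  then obtain n where j: "j = Suc n"
    by (cases j) auto
  \<comment> \<open>The summand \<open>i = j\<close> is split off, since \<open>V2_Suc'\<close>
    needs \<open>i + 1 \<le> j\<close>; its \<open>V2\<close> has the single factor
    \<open>y (Suc j)\<close>.\<close>
  have "(\<Sum>i=1..Suc j - 1. y i * V2 y (i + 1) (Suc j)) =
      y j * y (Suc j) + (\<Sum>i=1..n. y i * V2 y (i + 1) (Suc j))"
    by (simp add: j V2_self)
  also have "(\<Sum>i=1..n. y i * V2 y (i + 1) (Suc j)) =
      (y j + y (Suc j)) * (\<Sum>i=1..j - 1. y i * V2 y (i + 1) j)"
    unfolding sum_distrib_left by (rule sum.cong) (simp_all add: j V2_Suc' mult_ac)
  finally show ?case
    using step by (simp only: delta2_Suc)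
qed

end
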